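(* Let $\underline F_i\leqslant\overline F_i$ ($i=1,\ldots,n$) and $F_Z$ be distribution functions, and let $F_i\in\mathcal F_{(\underline F_i,\overline F_i)}$ for $i=1,\ldots,n$ be arbitrary. With $G_i,\underline G_i,\overline G_i$, $H,\underline H,\overline H$, generating functions $\varphi_i,\underline\varphi_i,\overline\varphi_i$, vectors $\pmb\varphi,\underline{\pmb\varphi},\overline{\pmb\varphi}$ and copulas $C^{\mathrm M}_{\pmb\varphi}$ as defined in the context, the following hold: (i) $\underline{\pmb\varphi}\leqslant\overline{\pmb\varphi}$. (ii) $C^{\mathrm M}_{\underline{\pmb\varphi}}\leqslant C^{\mathrm M}_{\pmb\varphi}\leqslant C^{\mathrm M}_{\overline{\pmb\varphi}}$ for every $C^{\mathrm M}_{\pmb\varphi}\in\mathcal C^{\mathrm M}$. (iii) $G_i=F_iF_Z$, $\underline G_i=\underline F_iF_Z$, $\overline G_i=\overline F_iF_Z$ for $i=1,\ldots,n$. (iv) For $i=1,\ldots,n$: $\varphi_i(G_i)=F_i$ if $G_i>0$; $\underline\varphi_i(\underline G_i)=\underline F_i$ if $\underline G_i>0$; $\overline\varphi_i(\overline G_i)=\overline F_i$ if $\overline G_i>0$. (v) For all $x_1,\ldots,x_n$, $$C^{\mathrm M}_{\underline{\pmb\varphi}}(\underline G_1(x_1),\ldots,\underline G_n(x_n))\leqslant C^{\mathrm M}_{\pmb\varphi}(G_1(x_1),\ldots,G_n(x_n))\leqslant C^{\mathrm M}_{\overline{\pmb\varphi}}(\overline G_1(x_1),\ldots,\overline G_n(x_n)).$$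 (vi) For all $x_1,\ldots,x_n$, $$H(x_1,\ldots,x_n)=C^{\mathrm M}_{\pmb\varphi}(G_1(x_1),\ldots,G_n(x_n)),$$ $$\underline H(x_1,\ldots,x_n)=C^{\mathrm M}_{\underline{\pmb\varphi}}(\underline G_1(x_1),\ldots,\underline G_n(x_n)),\qquad \overline H(x_1,\ldots,x_n)=C^{\mathrm M}_{\overline{\pmb\varphi}}(\overline G_1(x_1),\ldots,\overline G_n(x_n)).$$ (vii) For all $i,j=1,\ldots,n$ we have $\underline\varphi_i^*(\underline G_i)=\overline\varphi_j^*(\overline G_j)$ (both sides evaluated at the same point) if $\underline G_i,\overline G_j>0$ there. In (iv)--(vi), $\pmb\varphi=(\varphi_1,\ldots,\varphi_n)$ is the vector of generating functions constructed from $(F_1,\ldots,F_n,F_Z)$ by the extension formula in the context.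
   Context: "Increasing"/"decreasing" are meant in the weak sense; inequalities between functions are pointwise and between vectors of functions componentwise. Probabilities are finitely additive. A distribution function is an increasing map $F:\overline{\mathbb R}=\mathbb R\cup\{\pm\infty\}\to[0,1]$ with $F(-\infty)=0$, $F(+\infty)=1$ (no one-sided continuity is assumed). For distribution functions $\underline F\leqslant\overline F$, $\mathcal F_{(\underline F,\overline F)}$ is the set of all distribution functions $F$ with $\underline F\leqslant F\leqslant\overline F$. Marshall shock model: for independent $X_1,\ldots,X_n,Z$ with distribution functions $F_1,\ldots,F_n,F_Z$ let $U_i=\max\{X_i,Z\}$ have distribution function $G_i$, so $G_i=F_iF_Z$. The joint distribution function of $(U_1,\ldots,U_n)$ is $$H(x_1,\ldots,x_n)=F_1(x_1)\cdots F_n(x_n)\,F_Z(\min\{x_1,\ldots,x_n\}).$$ The functions $\underline G_i$, $\overline G_i$ are the pointwise infimum and supremum of $G_i$ as $F_i$ ranges over $\mathcal F_{(\underline F_i,\overline F_i)}$; $\underline H$, $\overline H$ are the pointwise minimum and maximum of $H$ as all $F_i$ range over $\mathcal F_{(\underline F_i,\overline F_i)}$ ($F_Z$ is fixed). Conditions (P1)--(P3) on $\varphi:[0,1]\to[0,1]$: (P1) $\varphi$ is increasing; (P2) $\varphi(0)=0$, $\varphi(1)=1$; (P3) $\varphi^*(u)=\varphi(u)/u:(0,1]\to[1,\infty]$ is decreasing. Extension formula. Write $F(x\pm)$ for one-sided limits, with $F(-\infty-)=F(-\infty)$ and $F(+\infty+)=F(+\infty)$. Given $F_i,F_Z$ and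 $G_i=F_iF_Z$, put $\varphi_i(0)=0$, $\varphi_i(1)=1$; for $u\in(0,1)$ choose any $x_0$ with $G_i(x_0-)\leqslant u\leqslant G_i(x_0+)$, put $u_-=G_i(x_0-)$, $u_l=F_i(x_0-)F_Z(x_0)$, $u_u=F_i(x_0+)F_Z(x_0)$, $u_+=G_i(x_0+)$, and let $$\varphi_i(u)=\begin{cases}F_i(x_0-)& u_-\leqslant u\leqslant u_l,\\ u/F_Z(x_0)& u_l\leqslant u\leqslant u_u,\\ F_i(x_0+)& u_u\leqslant u\leqslant u_+.\end{cases}$$ It is known that $\varphi_i$ satisfies (P1)--(P3), that $\varphi_i(G_i)=F_i$ where $G_i>0$, and that $F_i'\leqslant F_i$ implies $\varphi_i'\leqslant\varphi_i$ for the functions so constructed. Put $\pmb\varphi=(\varphi_1,\ldots,\varphi_n)$. Bounding generators: $\underline\varphi_i$ is the minimal function satisfying (P1)--(P3) and $\underline\varphi_i(\underline G_i)=\underline F_i$ where $\underline G_i>0$; $\overline\varphi_i$ is the maximal function satisfying (P1)--(P3) and $\overline\varphi_i(\overline G_i)=\overline F_i$ where $\overline G_i>0$. Put $\underline{\pmb\varphi}=(\underline\varphi_1,\ldots,\underline\varphi_n)$, $\overline{\pmb\varphi}=(\overline\varphi_1,\ldots,\overline\varphi_n)$, $\underline\varphi_i^*(u)=\underline\varphi_i(u)/u$, $\overline\varphi_i^*(u)=\overline\varphi_i(u)/u$. Multivariate Marshall's copula: for a vector $\pmb\varphi$ with components satisfying (P1)--(P3), $$C^{\mathrm M}_{\pmb\varphi}(u_1,\ldots,u_n)=\prod_{i=1}^n\varphi_i(u_i)\,\min_{i=1,\ldots,n}\left\{\frac{u_i}{\varphi_i(u_i)}\right\}$$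 if $\varphi_i(u_i)>0$ for all $i$, and $0$ otherwise. The $n$-variate imprecise Marshall's copula is $\mathcal C^{\mathrm M}=\{C^{\mathrm M}_{\pmb\varphi}:\underline{\pmb\varphi}\leqslant\pmb\varphi\leqslant\overline{\pmb\varphi},\text{ each component of }\pmb\varphi\text{ satisfying (P1)--(P3)}\}$. *)

theory Defs
  imports "HOL-Analysis.Analysis"
begin

section \<open>Distribution functions\<close>

text \<open>No one-sided continuity is required. That the values lie in \<open>[0,1]\<close> follows from
  monotonicity and the two boundary values.\<close>

definition distribution_function :: "(ereal \<Rightarrow> real) \<Rightarrow> bool" where
  "distribution_function F \<longleftrightarrow> mono F \<and> F (-\<infinity>) = 0 \<and> F \<infinity> = 1"

definition df_band :: "(ereal \<Rightarrow> real) \<Rightarrow> (ereal \<Rightarrow> real) \<Rightarrow> (ereal \<Rightarrow> real) set" where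
  "df_band L U = {F. distribution_function F \<and> L \<le> F \<and> F \<le> U}"

text \<open>The filters \<open>at_left (-\<infinity>)\<close> and \<open>at_right \<infinity>\<close> are trivial, so the end points need
  the separate conventions \<open>F(-\<infinity>-) = F(-\<infinity>)\<close> and \<open>F(\<infinity>+) = F(\<infinity>)\<close>.\<close>

definition left_lim :: "(ereal \<Rightarrow> real) \<Rightarrow> ereal \<Rightarrow> real" where
  "left_lim F x = (if x = -\<infinity> then F x else Lim (at_left x) F)"

definition right_lim :: "(ereal \<Rightarrow> real) \<Rightarrow> ereal \<Rightarrow> real" where
  "right_lim F x = (if x = \<infinity> then F x else Lim (at_right x) F)"

section \<open>Finitely additive probabilities\<close>

definition fa_prob :: "'w set \<Rightarrow> 'w set set \<Rightarrow> ('w set \<Rightarrow> real) \<Rightarrow> bool" where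
  "fa_prob \<Omega> \<A> P \<longleftrightarrow>
     algebra \<Omega> \<A> \<and> (\<forall>E\<in>\<A>. 0 \<le> P E) \<and> P \<Omega> = 1 \<and> additive \<A> P"

definition df_of :: "'w set \<Rightarrow> ('w set \<Rightarrow> real) \<Rightarrow> ('w \<Rightarrow> ereal) \<Rightarrow> ereal \<Rightarrow> real" where
  "df_of \<Omega> P Y x = P {\<omega>\<in>\<Omega>. Y \<omega> \<le> x}"

definition joint_df_of ::
  "'w set \<Rightarrow> ('w set \<Rightarrow> real) \<Rightarrow> ('n \<Rightarrow> 'w \<Rightarrow> ereal) \<Rightarrow> ('n \<Rightarrow> ereal) \<Rightarrow> real" where
  "joint_df_of \<Omega> P Y x = P {\<omega>\<in>\<Omega>. \<forall>i. Y i \<omega> \<le> x i}"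

text \<open>The random variables \<open>X i\<close> and \<open>Z\<close> are independent with distribution functions \<open>F i\<close>
  and \<open>FZ\<close>. Independence is required only on the events \<open>{X i \<le> x i}\<close>, \<open>{Z \<le> z}\<close>;
  subfamilies are covered by the argument \<open>\<infinity>\<close>.\<close>

definition shock_model ::
  "'w set \<Rightarrow> 'w set set \<Rightarrow> ('w set \<Rightarrow> real) \<Rightarrow> ('n::finite \<Rightarrow> 'w \<Rightarrow> ereal) \<Rightarrow> ('w \<Rightarrow> ereal)
    \<Rightarrow> ('n \<Rightarrow> ereal \<Rightarrow> real) \<Rightarrow> (ereal \<Rightarrow> real) \<Rightarrow> bool" where
  "shock_model \<Omega> \<A> P X Z F FZ \<longleftrightarrow>
     fa_prob \<Omega> \<A> P \<and>
     (\<forall>i x. {\<omega>\<in>\<Omega>. X i \<omega> \<le> x} \<in> \<A>) \<and> (\<forall>z. {\<omega>\<in>\<Omega>. Z \<omega> \<le> z} \<in> \<A>) \<and>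
     (\<forall>i. df_of \<Omega> P (X i) = F i) \<and> df_of \<Omega> P Z = FZ \<and>
     (\<forall>x z. P {\<omega>\<in>\<Omega>. (\<forall>i. X i \<omega> \<le> x i) \<and> Z \<omega> \<le> z}
          = (\<Prod>i\<in>UNIV. P {\<omega>\<in>\<Omega>. X i \<omega> \<le> x i}) * P {\<omega>\<in>\<Omega>. Z \<omega> \<le> z})"

section \<open>Marshall's shock model\<close>

definition marshall_G :: "(ereal \<Rightarrow> real) \<Rightarrow> (ereal \<Rightarrow> real) \<Rightarrow> ereal \<Rightarrow> real" where
  "marshall_G F FZ x = F x * FZ x"

definition marshall_H ::
  "('n::finite \<Rightarrow> ereal \<Rightarrow> real) \<Rightarrow> (ereal \<Rightarrow> real) \<Rightarrow> ('n \<Rightarrow> ereal) \<Rightarrow> real" where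
  "marshall_H F FZ x = (\<Prod>i\<in>UNIV. F i (x i)) * FZ (MIN i. x i)"

definition lower_G ::
  "(ereal \<Rightarrow> real) \<Rightarrow> (ereal \<Rightarrow> real) \<Rightarrow> (ereal \<Rightarrow> real) \<Rightarrow> ereal \<Rightarrow> real" where
  "lower_G L U FZ x = (INF F\<in>df_band L U. marshall_G F FZ x)"

definition upper_G ::
  "(ereal \<Rightarrow> real) \<Rightarrow> (ereal \<Rightarrow> real) \<Rightarrow> (ereal \<Rightarrow> real) \<Rightarrow> ereal \<Rightarrow> real" where
  "upper_G L U FZ x = (SUP F\<in>df_band L U. marshall_G F FZ x)"

text \<open>\<open>LEAST\<close> and \<open>GREATEST\<close> are the minimum and maximum; they are unspecified unless
  attained.\<close>

definition lower_H ::
  "('n::finite \<Rightarrow> ereal \<Rightarrow> real) \<Rightarrow> ('n \<Rightarrow> ereal \<Rightarrow> real) \<Rightarrow> (ereal \<Rightarrow> real)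
    \<Rightarrow> ('n \<Rightarrow> ereal) \<Rightarrow> real" where
  "lower_H L U FZ x =
     (LEAST h. \<exists>F. (\<forall>i. F i \<in> df_band (L i) (U i)) \<and> h = marshall_H F FZ x)"

definition upper_H ::
  "('n::finite \<Rightarrow> ereal \<Rightarrow> real) \<Rightarrow> ('n \<Rightarrow> ereal \<Rightarrow> real) \<Rightarrow> (ereal \<Rightarrow> real)
    \<Rightarrow> ('n \<Rightarrow> ereal) \<Rightarrow> real" where
  "upper_H L U FZ x =
     (GREATEST h. \<exists>F. (\<forall>i. F i \<in> df_band (L i) (U i)) \<and> h = marshall_H F FZ x)"

section \<open>Generating functions\<close>

text \<open>Generating functions are maps from \<open>[0,1]\<close> to \<open>[0,1]\<close>; they are represented by
  functions on \<open>real\<close> whose values outside \<open>[0,1]\<close> are irrelevant.\<close>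

definition gen_star :: "(real \<Rightarrow> real) \<Rightarrow> real \<Rightarrow> real" where
  "gen_star \<phi> u = \<phi> u / u"

definition generator :: "(real \<Rightarrow> real) \<Rightarrow> bool" where
  "generator \<phi> \<longleftrightarrow>
     \<phi> ` {0..1} \<subseteq> {0..1} \<and>
     mono_on {0..1} \<phi> \<and>
     \<phi> 0 = 0 \<and> \<phi> 1 = 1 \<and>
     gen_star \<phi> ` {0<..1} \<subseteq> {1..} \<and> antimono_on {0<..1} (gen_star \<phi>)"

definition le_on_unit :: "(real \<Rightarrow> real) \<Rightarrow> (real \<Rightarrow> real) \<Rightarrow> bool" where
  "le_on_unit \<phi> \<psi> \<longleftrightarrow> (\<forall>u\<in>{0..1}. \<phi> u \<le> \<psi> u)"

definition generates ::
  "(real \<Rightarrow> real) \<Rightarrow> (ereal \<Rightarrow> real) \<Rightarrow> (ereal \<Rightarrow> real) \<Rightarrow> bool" where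
  "generates \<phi> G F \<longleftrightarrow> (\<forall>x. G x > 0 \<longrightarrow> \<phi> (G x) = F x)"

definition minimal_generator ::
  "(ereal \<Rightarrow> real) \<Rightarrow> (ereal \<Rightarrow> real) \<Rightarrow> (real \<Rightarrow> real) \<Rightarrow> bool" where
  "minimal_generator G F \<phi> \<longleftrightarrow>
     generator \<phi> \<and> generates \<phi> G F \<and>
     (\<forall>\<psi>. generator \<psi> \<and> generates \<psi> G F \<longrightarrow> le_on_unit \<phi> \<psi>)"

definition maximal_generator ::
  "(ereal \<Rightarrow> real) \<Rightarrow> (ereal \<Rightarrow> real) \<Rightarrow> (real \<Rightarrow> real) \<Rightarrow> bool" where
  "maximal_generator G F \<phi> \<longleftrightarrow>
     generator \<phi> \<and> generates \<phi> G F \<and>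
     (\<forall>\<psi>. generator \<psi> \<and> generates \<psi> G F \<longrightarrow> le_on_unit \<psi> \<phi>)"

text \<open>With \<open>u\<^sub>l = F(x\<^sub>0-) FZ(x\<^sub>0)\<close> and \<open>u\<^sub>u = F(x\<^sub>0+) FZ(x\<^sub>0)\<close>, the value at a \<open>u\<close> with
  \<open>G(x\<^sub>0-) \<le> u \<le> G(x\<^sub>0+)\<close>. For \<open>u > 0\<close> the three cases agree where they overlap, and the
  middle case can occur only if \<open>FZ(x\<^sub>0) > 0\<close>.\<close>

definition ext_value ::
  "(ereal \<Rightarrow> real) \<Rightarrow> (ereal \<Rightarrow> real) \<Rightarrow> ereal \<Rightarrow> real \<Rightarrow> real" where
  "ext_value F FZ x0 u =
     (if u \<le> left_lim F x0 * FZ x0 then left_lim F x0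
      else if u \<le> right_lim F x0 * FZ x0 then u / FZ x0
      else right_lim F x0)"

text \<open>\<open>\<phi>\<close> results from the extension formula for some choice, at each \<open>u\<close>, of an
  admissible \<open>x\<^sub>0\<close>.\<close>

definition is_extension ::
  "(ereal \<Rightarrow> real) \<Rightarrow> (ereal \<Rightarrow> real) \<Rightarrow> (real \<Rightarrow> real) \<Rightarrow> bool" where
  "is_extension F FZ \<phi> \<longleftrightarrow>
     \<phi> 0 = 0 \<and> \<phi> 1 = 1 \<and>
     (\<forall>u\<in>{0<..<1}. \<exists>x0.
        left_lim (marshall_G F FZ) x0 \<le> u \<and> u \<le> right_lim (marshall_G F FZ) x0 \<and>
        \<phi> u = ext_value F FZ x0 u)"

section \<open>Marshall's copulas\<close>

definition marshall_copula ::
  "('n::finite \<Rightarrow> real \<Rightarrow> real) \<Rightarrow> ('n \<Rightarrow> real) \<Rightarrow> real" where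
  "marshall_copula \<phi> u =
     (if \<forall>i. \<phi> i (u i) > 0
      then (\<Prod>i\<in>UNIV. \<phi> i (u i)) * (MIN i. u i / \<phi> i (u i))
      else 0)"

definition imprecise_marshall_copula ::
  "('n::finite \<Rightarrow> real \<Rightarrow> real) \<Rightarrow> ('n \<Rightarrow> real \<Rightarrow> real) \<Rightarrow> (('n \<Rightarrow> real) \<Rightarrow> real) set" where
  "imprecise_marshall_copula \<phi>l \<phi>u =
     {marshall_copula \<phi> |\<phi>.
        \<forall>i. generator (\<phi> i) \<and> le_on_unit (\<phi>l i) (\<phi> i) \<and> le_on_unit (\<phi> i) (\<phi>u i)}"

end

theory Submission
  imports Defs
begin

text \<open>Wherever \<open>F FZ > 0\<close>, a generator \<open>\<phi>\<close> with \<open>\<phi> (F FZ) = F\<close> satisfies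
  \<open>F FZ / \<phi> (F FZ) = FZ\<close>. The factor \<open>MIN i. u i / \<phi> i (u i)\<close> in Marshall's copula therefore
  becomes \<open>MIN i. FZ (x i) = FZ (MIN i. x i)\<close>, which is the common shock factor in the joint
  distribution function \<open>H\<close> (lemma \<open>marshall_H_eq_copula\<close>); where some \<open>F i FZ\<close> vanishes, both
  sides are \<open>0\<close>. This one identity, applied to the given, the lower and the upper
  margins, gives all representations of \<open>H\<close> and its bounds. Since \<open>F \<mapsto> F FZ\<close> and
  \<open>F \<mapsto> H\<close> are monotone, the extrema over a band of distribution functions are attained at its end
  points, and the inequalities between the composed copulas reduce to monotonicity of \<open>H\<close>.

  That the extension formula reproduces \<open>F\<close> (lemma \<open>is_extension_generates\<close>) has to be checked
  for an arbitrary admissible \<open>x\<^sub>0\<close>. If \<open>u = F x * FZ x > 0\<close> and \<open>x\<^sub>0 \<noteq> x\<close>, then the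
  product \<open>F FZ\<close> is constant from \<open>x\<close> up to, but not including, \<open>x\<^sub>0\<close>. A positive product of
  increasing functions is constant only if both factors are, so the one-sided limit of \<open>F\<close> at \<open>x\<^sub>0\<close> is \<open>F x\<close>.

  The one inequality that uses extremality is between the two bounding generators
  (lemma \<open>minimal_generator_le_maximal\<close>). The class of generators is closed under maxima
  and under truncation by a line \<open>v \<mapsto> v / c\<close> with \<open>0 < c \<le> 1\<close>. Truncation together with minimality
  shows that the minimal generator \<open>\<phi>\<close> stays below the upper constraints, that is
  \<open>\<phi> (Fu FZ) \<le> Fu\<close>; hence its maximum with the maximal generator still meets those
  constraints, and maximality bounds \<open>\<phi>\<close>.\<close>

section \<open>One-sided limits of distribution functions\<close>

lemma distribution_function_bounds:
  assumes "distribution_function F"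
  shows "0 \<le> F x" "F x \<le> 1"
  using assms monoD[of F "-\<infinity>" x] monoD[of F x "\<infinity>"]
  by (auto simp: distribution_function_def)

lemma distribution_function_mono:
  assumes "distribution_function F" "x \<le> y"
  shows "F x \<le> F y"
  using assms monoD[of F x y] by (auto simp: distribution_function_def)

lemma distribution_function_marshall_G:
  assumes "distribution_function F" "distribution_function FZ"
  shows "distribution_function (marshall_G F FZ)"
proof -
  have "mono (marshall_G F FZ)"
    unfolding marshall_G_def
    by (intro monoI mult_mono distribution_function_mono distribution_function_bounds assms)
  then show ?thesis using assms by (simp add: distribution_function_def marshall_G_def)
qed

text \<open>A value \<open>Lim\<close> carries information only where the limit exists. For a bounded increasing
  function it does, and it is a supremum or an infimum of values.\<close>

lemma left_lim_eq_SUP: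
  assumes F: "distribution_function F" and x: "x \<noteq> -\<infinity>"
  shows "left_lim F x = (SUP y\<in>{..<x}. F y)"
proof -
  have ne: "-\<infinity> \<in> {..<x}" using x by (cases x) auto
  have bdd: "bdd_above (F ` {..<x})"
    using distribution_function_bounds[OF F] by (auto simp: bdd_above_def)
  have "(F \<longlongrightarrow> (SUP y\<in>{..<x}. F y)) (at_left x)"
  proof (rule order_tendstoI)
    fix a assume "a < (SUP y\<in>{..<x}. F y)"
    then obtain y where y: "y < x" "a < F y"
      using less_cSUP_iff[OF _ bdd, of a] ne by auto
    then show "eventually (\<lambda>z. a < F z) (at_left x)"
      unfolding eventually_at_left[OF y(1)]
      using distribution_function_mono[OF F] by (meson less_imp_le less_le_trans)
  next
    fix a assume a: "(SUP y\<in>{..<x}. F y) < a"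
    have "F z < a" if "z < x" for z
      using cSUP_upper[OF _ bdd, of z] that a by auto
    then show "eventually (\<lambda>z. F z < a) (at_left x)"
      unfolding eventually_at_filter by auto
  qed
  moreover have "at_left x \<noteq> bot"
    using ne by (metis lessThan_iff eventually_False eventually_at_left dense)
  ultimately show ?thesis
    using x tendsto_Lim by (auto simp: left_lim_def)
qed

lemma right_lim_eq_INF:
  assumes F: "distribution_function F" and x: "x \<noteq> \<infinity>"
  shows "right_lim F x = (INF y\<in>{x<..}. F y)"
proof -
  have ne: "\<infinity> \<in> {x<..}" using x by (cases x) auto
  have bdd: "bdd_below (F ` {x<..})"
    using distribution_function_bounds[OF F] by (auto simp: bdd_below_def)
  have "(F \<longlongrightarrow> (INF y\<in>{x<..}. F y)) (at_right x)"
  proof (rule order_tendstoI)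
    fix a assume "(INF y\<in>{x<..}. F y) < a"
    then obtain y where y: "x < y" "F y < a"
      using cINF_less_iff[OF _ bdd, of a] ne by auto
    then show "eventually (\<lambda>z. F z < a) (at_right x)"
      unfolding eventually_at_right[OF y(1)]
      using distribution_function_mono[OF F] by (meson less_imp_le le_less_trans)
  next
    fix a assume a: "a < (INF y\<in>{x<..}. F y)"
    have "a < F z" if "x < z" for z
      using cINF_lower[OF bdd, of z] that a by auto
    then show "eventually (\<lambda>z. a < F z) (at_right x)"
      unfolding eventually_at_filter by auto
  qed
  moreover have "at_right x \<noteq> bot"
    using ne by (metis greaterThan_iff eventually_False eventually_at_right dense)
  ultimately show ?thesis
    using x tendsto_Lim by (auto simp: right_lim_def)
qed

lemma le_left_lim:
  assumes F: "distribution_function F" and "y < x"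
  shows "F y \<le> left_lim F x"
proof -
  have "bdd_above (F ` {..<x})"
    using distribution_function_bounds[OF F] by (auto simp: bdd_above_def)
  moreover have "x \<noteq> -\<infinity>" using \<open>y < x\<close> by auto
  ultimately show ?thesis
    using assms by (auto simp: left_lim_eq_SUP intro: cSUP_upper)
qed

lemma left_lim_le:
  assumes F: "distribution_function F"
  shows "left_lim F x \<le> F x"
proof (cases "x = -\<infinity>")
  case False
  then have "-\<infinity> \<in> {..<x}" by (cases x) auto
  then show ?thesis
    using False distribution_function_mono[OF F]
    by (auto simp: left_lim_eq_SUP[OF F] less_imp_le intro!: cSUP_least)
qed (simp add: left_lim_def)

lemma right_lim_le:
  assumes F: "distribution_function F" and "x < y"
  shows "right_lim F x \<le> F y"
proof -
  have "bdd_below (F ` {x<..})"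
    using distribution_function_bounds[OF F] by (auto simp: bdd_below_def)
  moreover have "x \<noteq> \<infinity>" using \<open>x < y\<close> by auto
  ultimately show ?thesis
    using assms by (auto simp: right_lim_eq_INF intro: cINF_lower)
qed

lemma le_right_lim:
  assumes F: "distribution_function F"
  shows "F x \<le> right_lim F x"
proof (cases "x = \<infinity>")
  case False
  then have "\<infinity> \<in> {x<..}" by (cases x) auto
  then show ?thesis
    using False distribution_function_mono[OF F]
    by (auto simp: right_lim_eq_INF[OF F] less_imp_le intro!: cINF_greatest)
qed (simp add: right_lim_def)

lemma left_lim_eq_if_constant:
  assumes F: "distribution_function F" and "y < x"
    and const: "\<And>z. y \<le> z \<Longrightarrow> z < x \<Longrightarrow> F z = F y"
  shows "left_lim F x = F y"
proof (rule antisym)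
  have "F z \<le> F y" if "z < x" for z
    using that const[of z] distribution_function_mono[OF F, of z y] by fastforce
  moreover have "x \<noteq> -\<infinity>" using \<open>y < x\<close> by auto
  ultimately show "left_lim F x \<le> F y"
    using \<open>y < x\<close> by (auto simp: left_lim_eq_SUP[OF F] intro!: cSUP_least)
qed (rule le_left_lim[OF F \<open>y < x\<close>])

lemma right_lim_eq_if_constant:
  assumes F: "distribution_function F" and "x < y"
    and const: "\<And>z. x < z \<Longrightarrow> z \<le> y \<Longrightarrow> F z = F y"
  shows "right_lim F x = F y"
proof (rule antisym)
  have "F y \<le> F z" if "x < z" for z
    using that const[of z] distribution_function_mono[OF F, of y z] by fastforce
  moreover have "x \<noteq> \<infinity>" using \<open>x < y\<close> by auto
  ultimately show "F y \<le> right_lim F x"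
    using \<open>x < y\<close> by (auto simp: right_lim_eq_INF[OF F] intro!: cINF_greatest)
qed (rule right_lim_le[OF F \<open>x < y\<close>])

section \<open>The extension formula\<close>

text \<open>Positivity is essential: a flat piece where \<open>F FZ = 0\<close> would say nothing about the factor
  that is multiplied by \<open>0\<close>. Here it lets flatness of \<open>F FZ\<close> pass to \<open>F\<close> and to \<open>FZ\<close>.\<close>

lemma factors_eq_if_product_le:
  fixes a b c d :: real
  assumes "0 \<le> a" "0 \<le> b" "0 < a * b" "a \<le> c" "b \<le> d" "c * d \<le> a * b"
  shows "c = a" "d = b"
proof -
  have pos: "0 < a" "0 < b" using assms by (auto simp: zero_less_mult_iff)
  have "a * d \<le> c * d" "c * b \<le> c * d"
    using assms pos by (auto intro: mult_right_mono mult_left_mono)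
  with assms have "a * d \<le> a * b" "c * b \<le> a * b" by auto
  then have "d \<le> b" "c \<le> a" using pos by auto
  with assms show "c = a" "d = b" by auto
qed

lemma factors_eq_if_marshall_G_le:
  assumes F: "distribution_function F" and FZ: "distribution_function FZ"
    and "x \<le> y" "0 < marshall_G F FZ x" "marshall_G F FZ y \<le> marshall_G F FZ x"
  shows "F y = F x" "FZ y = FZ x"
  using factors_eq_if_product_le[of "F x" "FZ x" "F y" "FZ y"] assms
    distribution_function_bounds[OF F] distribution_function_bounds[OF FZ]
    distribution_function_mono[OF F] distribution_function_mono[OF FZ]
  by (auto simp: marshall_G_def)

text \<open>The value of the extension formula at \<open>u = F x * FZ x\<close> does not depend on the admissible
  point: \<open>x\<^sub>0\<close> need not be \<open>x\<close>, but \<open>F FZ\<close> is then flat between the two.\<close>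

lemma ext_value_marshall_G:
  assumes F: "distribution_function F" and FZ: "distribution_function FZ"
    and pos: "0 < marshall_G F FZ x"
    and left: "left_lim (marshall_G F FZ) x0 \<le> marshall_G F FZ x"
    and right: "marshall_G F FZ x \<le> right_lim (marshall_G F FZ) x0"
  shows "ext_value F FZ x0 (marshall_G F FZ x) = F x"
proof -
  note G = distribution_function_marshall_G[OF F FZ]
  have nonneg: "0 \<le> F z" "0 \<le> FZ z" for z
    using distribution_function_bounds[OF F] distribution_function_bounds[OF FZ] by auto
  have Fpos: "0 < F x" "0 < FZ x"
    using pos nonneg[of x] by (auto simp: marshall_G_def zero_less_mult_iff)
  consider "x < x0" | "x = x0" | "x0 < x" by fastforce
  then show ?thesis
  proof cases
    case 1
    have "F z = F x" if "x \<le> z" "z < x0" for z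
      using factors_eq_if_marshall_G_le[OF F FZ that(1) pos] le_left_lim[OF G that(2)] left
      by auto
    then have "left_lim F x0 = F x" by (rule left_lim_eq_if_constant[OF F 1])
    moreover have "F x * FZ x \<le> F x * FZ x0"
      using 1 Fpos distribution_function_mono[OF FZ] by (auto intro: mult_left_mono)
    ultimately show ?thesis by (simp add: ext_value_def marshall_G_def)
  next
    case 2
    then show ?thesis
      using Fpos left_lim_le[OF F, of x0] le_right_lim[OF F, of x0]
      by (auto simp: ext_value_def marshall_G_def)
  next
    case 3
    have "F z = F x" if "x0 < z" "z \<le> x" for z
    proof -
      have le: "marshall_G F FZ x \<le> marshall_G F FZ z"
        using right_lim_le[OF G that(1)] right by auto
      then show ?thesis
        using factors_eq_if_marshall_G_le[OF F FZ that(2)] pos by auto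
    qed
    then have lim: "right_lim F x0 = F x" by (rule right_lim_eq_if_constant[OF F 3])
    have le: "left_lim F x0 \<le> F x0" "F x0 \<le> F x" "FZ x0 \<le> FZ x"
      using left_lim_le[OF F] 3 distribution_function_mono[OF F] distribution_function_mono[OF FZ]
      by (auto simp: less_imp_le)
    show ?thesis
    proof (cases "marshall_G F FZ x \<le> left_lim F x0 * FZ x0")
      case True
      also have "left_lim F x0 * FZ x0 \<le> F x0 * FZ x0"
        using le nonneg by (auto intro: mult_right_mono)
      finally have "F x * FZ x \<le> F x0 * FZ x0" by (simp add: marshall_G_def)
      then have eq: "F x = F x0" "FZ x = FZ x0"
        using factors_eq_if_marshall_G_le[OF F FZ, of x0 x] 3 le pos
        by (auto simp: marshall_G_def)
      then have "F x \<le> left_lim F x0" using True Fpos by (simp add: marshall_G_def)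
      then show ?thesis using True le by (simp add: ext_value_def)
    next
      case False
      \<comment> \<open>In the middle case \<open>F x * FZ x \<le> F x * FZ x0\<close>, so \<open>FZ\<close> is constant between \<open>x0\<close>
        and \<open>x\<close>, and dividing by \<open>FZ x0\<close> gives back \<open>F x\<close>.\<close>
      have "FZ x0 = FZ x" if "marshall_G F FZ x \<le> right_lim F x0 * FZ x0"
        using that lim le Fpos by (auto simp: marshall_G_def)
      then show ?thesis using False lim Fpos by (auto simp: ext_value_def marshall_G_def)
    qed
  qed
qed

lemma is_extension_generates:
  assumes F: "distribution_function F" and FZ: "distribution_function FZ"
    and ext: "is_extension F FZ \<phi>"
  shows "generates \<phi> (marshall_G F FZ) F"
  unfolding generates_def
proof (intro allI impI)
  fix x assume pos: "0 < marshall_G F FZ x"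
  note G = distribution_function_marshall_G[OF F FZ]
  show "\<phi> (marshall_G F FZ x) = F x"
  proof (cases "marshall_G F FZ x = 1")
    case True
    \<comment> \<open>The value \<open>\<phi> 1 = 1\<close> is prescribed, and a product of two numbers in \<open>[0,1]\<close> is \<open>1\<close>
      only if both are.\<close>
    have "F x * FZ x \<le> F x * 1"
      using distribution_function_bounds[OF F] distribution_function_bounds[OF FZ]
      by (intro mult_left_mono) auto
    then have "F x = 1"
      using True distribution_function_bounds(2)[OF F, of x] by (auto simp: marshall_G_def)
    then show ?thesis using True ext by (simp add: is_extension_def)
  next
    case False
    then have "marshall_G F FZ x \<in> {0<..<1}"
      using pos distribution_function_bounds(2)[OF G, of x] by auto
    then obtain x0 where "left_lim (marshall_G F FZ) x0 \<le> marshall_G F FZ x"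
      "marshall_G F FZ x \<le> right_lim (marshall_G F FZ) x0"
      "\<phi> (marshall_G F FZ x) = ext_value F FZ x0 (marshall_G F FZ x)"
      using ext unfolding is_extension_def by blast
    then show ?thesis using ext_value_marshall_G[OF F FZ pos] by simp
  qed
qed

section \<open>Generators and the order of the bounding generators\<close>

text \<open>Multiplying out the monotonicity of \<open>\<phi> u / u\<close> avoids the point \<open>0\<close>, and makes the
  bounds on \<open>\<phi>\<close> and on \<open>\<phi> u / u\<close> consequences of the values at \<open>0\<close> and \<open>1\<close>.\<close>

lemma generator_iff:
  "generator \<phi> \<longleftrightarrow> \<phi> 0 = 0 \<and> \<phi> 1 = 1 \<and>
     (\<forall>u v. 0 \<le> u \<longrightarrow> u \<le> v \<longrightarrow> v \<le> 1 \<longrightarrow> \<phi> u \<le> \<phi> v \<and> u * \<phi> v \<le> v * \<phi> u)"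
    (is "_ \<longleftrightarrow> ?R")
proof
  assume g: "generator \<phi>"
  have "u * \<phi> v \<le> v * \<phi> u" if "0 \<le> u" "u \<le> v" "v \<le> 1" for u v
  proof (cases "u = 0")
    case False
    then have "gen_star \<phi> v \<le> gen_star \<phi> u"
      using g that by (auto simp: generator_def monotone_on_def)
    then show ?thesis using False that by (simp add: gen_star_def field_simps)
  qed (use g in \<open>auto simp: generator_def\<close>)
  then show ?R using g by (auto simp: generator_def monotone_on_def)
next
  assume R: ?R
  have "0 \<le> \<phi> u" "\<phi> u \<le> 1" if "0 \<le> u" "u \<le> 1" for u
    using R that by (metis order_refl)+
  moreover have "1 \<le> gen_star \<phi> u" if "0 < u" "u \<le> 1" for u
  proof -
    have "u * \<phi> 1 \<le> 1 * \<phi> u" using R that by (meson less_imp_le order_refl)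
    then show ?thesis using R that by (simp add: gen_star_def)
  qed
  moreover have "gen_star \<phi> v \<le> gen_star \<phi> u" if "0 < u" "u \<le> v" "v \<le> 1" for u v
  proof -
    have "u * \<phi> v \<le> v * \<phi> u" using R that by (meson less_imp_le)
    then show ?thesis using that by (simp add: gen_star_def field_simps)
  qed
  ultimately show "generator \<phi>"
    using R unfolding generator_def by (auto simp: monotone_on_def image_subset_iff)
qed

lemma generator_max:
  assumes "generator \<phi>" "generator \<psi>"
  shows "generator (\<lambda>v. max (\<phi> v) (\<psi> v))"
  unfolding generator_iff
proof (intro conjI allI impI)
  fix u v :: real assume uv: "0 \<le> u" "u \<le> v" "v \<le> 1"
  then have *: "\<phi> u \<le> \<phi> v" "\<psi> u \<le> \<psi> v" "u * \<phi> v \<le> v * \<phi> u" "u * \<psi> v \<le> v * \<psi> u"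
    using assms by (auto simp: generator_iff)
  then show "max (\<phi> u) (\<psi> u) \<le> max (\<phi> v) (\<psi> v)" by auto
  show "u * max (\<phi> v) (\<psi> v) \<le> v * max (\<phi> u) (\<psi> u)"
    using uv * by (simp add: max_mult_distrib_left max.coboundedI1 max.coboundedI2)
qed (use assms in \<open>auto simp: generator_iff\<close>)

lemma generator_min_line:
  assumes "generator \<phi>" "0 < c" "c \<le> 1"
  shows "generator (\<lambda>v. min (\<phi> v) (v / c))"
  unfolding generator_iff
proof (intro conjI allI impI)
  fix u v :: real assume uv: "0 \<le> u" "u \<le> v" "v \<le> 1"
  then have *: "\<phi> u \<le> \<phi> v" "u * \<phi> v \<le> v * \<phi> u" "u / c \<le> v / c"
    using assms by (auto simp: generator_iff divide_right_mono)
  then show "min (\<phi> u) (u / c) \<le> min (\<phi> v) (v / c)" by auto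
  show "u * min (\<phi> v) (v / c) \<le> v * min (\<phi> u) (u / c)"
    using uv * by (simp add: min_mult_distrib_left min.coboundedI1 min.coboundedI2 mult.commute)
qed (use assms in \<open>auto simp: generator_iff\<close>)

text \<open>The claim is that \<open>\<phi> u / u \<le> 1 / FZ x\<close> at \<open>u = Fu x * FZ x\<close>. If \<open>Fl x > 0\<close>, equality
  holds at the smaller point \<open>Fl x * FZ x\<close>, and \<open>\<phi> u / u\<close> decreases. If \<open>Fl x = 0\<close>, every constraint on \<open>\<phi>\<close> comes from a point to the right of \<open>x\<close>, hence has slope at most
  \<open>1 / FZ x\<close>; truncation by the line of that slope keeps all constraints.\<close>

lemma minimal_generator_le_upper:
  assumes Fl: "distribution_function Fl" and Fu: "distribution_function Fu" and le: "Fl \<le> Fu"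
    and FZ: "distribution_function FZ"
    and min: "minimal_generator (marshall_G Fl FZ) Fl \<phi>"
    and pos: "0 < marshall_G Fu FZ x"
  shows "\<phi> (marshall_G Fu FZ x) \<le> Fu x"
proof -
  let ?u = "marshall_G Fu FZ x"
  have gen: "generator \<phi>" and gens: "generates \<phi> (marshall_G Fl FZ) Fl"
    using min by (auto simp: minimal_generator_def)
  have Zpos: "0 < FZ x"
    using pos distribution_function_bounds(1)[OF Fu, of x] distribution_function_bounds(1)[OF FZ, of x]
    by (auto simp: marshall_G_def zero_less_mult_iff)
  have Z1: "FZ x \<le> 1" using distribution_function_bounds[OF FZ] by auto
  have u1: "?u \<le> 1"
    using distribution_function_bounds[OF distribution_function_marshall_G[OF Fu FZ]] by auto
  have "\<phi> ?u \<le> ?u / FZ x"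
  proof (cases "Fl x = 0")
    case False
    then have Flpos: "0 < Fl x" using distribution_function_bounds(1)[OF Fl, of x] by auto
    let ?l = "marshall_G Fl FZ x"
    have "0 < ?l" using Flpos Zpos by (simp add: marshall_G_def)
    moreover from this have "\<phi> ?l = Fl x" using gens by (auto simp: generates_def)
    moreover have "?l \<le> ?u"
      using le Zpos by (auto simp: marshall_G_def le_fun_def intro: mult_right_mono)
    ultimately have "?l * \<phi> ?u \<le> ?u * Fl x"
      using gen u1 by (metis generator_iff less_imp_le)
    then show ?thesis using Flpos Zpos by (simp add: marshall_G_def field_simps)
  next
    case True
    let ?\<psi> = "\<lambda>v. min (\<phi> v) (v / FZ x)"
    have "generates ?\<psi> (marshall_G Fl FZ) Fl"
      unfolding generates_def
    proof (intro allI impI)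
      fix y assume y: "0 < marshall_G Fl FZ y"
      then have Fly: "0 < Fl y"
        using distribution_function_bounds(1)[OF Fl, of y] distribution_function_bounds(1)[OF FZ, of y]
        by (auto simp: marshall_G_def zero_less_mult_iff)
      then have "x \<le> y"
        using True distribution_function_mono[OF Fl, of y x] by fastforce
      then have "FZ x \<le> FZ y" using distribution_function_mono[OF FZ] by auto
      then have "Fl y \<le> marshall_G Fl FZ y / FZ x"
        using Zpos Fly by (simp add: marshall_G_def field_simps)
      then show "?\<psi> (marshall_G Fl FZ y) = Fl y"
        using gens y by (simp add: generates_def)
    qed
    then have "le_on_unit \<phi> ?\<psi>"
      using min generator_min_line[OF gen Zpos Z1] by (auto simp: minimal_generator_def)
    then show ?thesis using pos u1 by (auto simp: le_on_unit_def)
  qed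
  then show ?thesis using Zpos by (simp add: marshall_G_def)
qed

lemma minimal_generator_le_maximal:
  assumes Fl: "distribution_function Fl" and Fu: "distribution_function Fu" and le: "Fl \<le> Fu"
    and FZ: "distribution_function FZ"
    and min: "minimal_generator (marshall_G Fl FZ) Fl \<phi>"
    and max: "maximal_generator (marshall_G Fu FZ) Fu \<psi>"
  shows "le_on_unit \<phi> \<psi>"
proof -
  let ?m = "\<lambda>v. max (\<phi> v) (\<psi> v)"
  have "generates ?m (marshall_G Fu FZ) Fu"
    using max minimal_generator_le_upper[OF Fl Fu le FZ min]
    by (auto simp: maximal_generator_def generates_def)
  moreover have "generator ?m"
    using min max by (intro generator_max) (auto simp: minimal_generator_def maximal_generator_def)
  ultimately have "le_on_unit ?m \<psi>" using max by (auto simp: maximal_generator_def)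
  then show ?thesis by (auto simp: le_on_unit_def)
qed

section \<open>Marshall's copula as a function of its generators\<close>

text \<open>Cancelling \<open>\<phi> i (u i)\<close> against the denominator leaves a minimum of products in which the
  generators occur only as factors, so that monotonicity in the generators becomes visible.\<close>

lemma marshall_copula_eq_Min:
  assumes pos: "\<And>i. 0 < \<phi> i (u i)"
  shows "marshall_copula \<phi> u = (MIN i. u i * (\<Prod>j\<in>UNIV - {i}. \<phi> j (u j)))"
proof -
  let ?p = "\<Prod>i\<in>UNIV. \<phi> i (u i)"
  have p: "0 < ?p" using pos by (simp add: prod_pos)
  have "?p * (MIN i. u i / \<phi> i (u i)) = Min ((\<lambda>t. ?p * t) ` range (\<lambda>i. u i / \<phi> i (u i)))"
    using p by (intro mono_Min_commute) (auto intro!: monoI mult_left_mono)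
  also have "(\<lambda>t. ?p * t) ` range (\<lambda>i. u i / \<phi> i (u i))
      = range (\<lambda>i. u i * (\<Prod>j\<in>UNIV - {i}. \<phi> j (u j)))"
  proof -
    have "?p * (u i / \<phi> i (u i)) = u i * (\<Prod>j\<in>UNIV - {i}. \<phi> j (u j))" for i
      using pos[of i] by (simp add: prod.remove[of UNIV i])
    then show ?thesis by (simp add: image_image)
  qed
  finally show ?thesis using pos by (simp add: marshall_copula_def)
qed

lemma marshall_copula_nonneg:
  assumes "\<And>i. 0 \<le> u i"
  shows "0 \<le> marshall_copula \<phi> u"
  using assms
  by (auto simp: marshall_copula_def less_imp_le intro!: mult_nonneg_nonneg prod_nonneg)

lemma marshall_copula_mono:
  assumes u: "\<And>i. 0 \<le> u i" and le: "\<And>i. \<phi> i (u i) \<le> \<psi> i (u i)"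
  shows "marshall_copula \<phi> u \<le> marshall_copula \<psi> u"
proof (cases "\<forall>i. 0 < \<phi> i (u i)")
  case True
  then have "0 < \<psi> i (u i)" for i using le[of i] by (meson less_le_trans)
  moreover have "(MIN i. u i * (\<Prod>j\<in>UNIV - {i}. \<phi> j (u j)))
      \<le> (MIN i. u i * (\<Prod>j\<in>UNIV - {i}. \<psi> j (u j)))"
  proof (rule Min.boundedI)
    fix a assume "a \<in> range (\<lambda>i. u i * (\<Prod>j\<in>UNIV - {i}. \<psi> j (u j)))"
    then obtain i where i: "a = u i * (\<Prod>j\<in>UNIV - {i}. \<psi> j (u j))" by auto
    have "(MIN i. u i * (\<Prod>j\<in>UNIV - {i}. \<phi> j (u j))) \<le> u i * (\<Prod>j\<in>UNIV - {i}. \<phi> j (u j))"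
      by (intro Min_le) auto
    also have "\<dots> \<le> a"
      unfolding i using True u le by (auto intro!: mult_left_mono prod_mono simp: less_imp_le)
    finally show "(MIN i. u i * (\<Prod>j\<in>UNIV - {i}. \<phi> j (u j))) \<le> a" .
  qed auto
  ultimately show ?thesis using True by (simp add: marshall_copula_eq_Min)
next
  case False
  then have "marshall_copula \<phi> u = 0" by (auto simp: marshall_copula_def)
  then show ?thesis using marshall_copula_nonneg[OF u] by simp
qed

section \<open>The joint distribution function\<close>

text \<open>The minimum of the quotients \<open>u i / \<phi> i (u i) = FZ (x i)\<close> is taken inside \<open>FZ\<close>, because \<open>FZ\<close>
  is increasing and only finitely many points are involved.\<close>

lemma marshall_H_eq_copula:
  fixes F :: "'n::finite \<Rightarrow> ereal \<Rightarrow> real"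
  assumes F: "\<And>i. distribution_function (F i)" and FZ: "distribution_function FZ"
    and zero: "\<And>i. \<phi> i 0 = 0" and gens: "\<And>i. generates (\<phi> i) (marshall_G (F i) FZ) (F i)"
  shows "marshall_H F FZ x = marshall_copula \<phi> (\<lambda>i. marshall_G (F i) FZ (x i))"
proof -
  have min: "FZ (MIN i. x i) = (MIN i. FZ (x i))"
    using FZ mono_Min_commute[of FZ "range x"] by (simp add: distribution_function_def image_image)
  have nonneg: "0 \<le> F i y" "0 \<le> FZ y" for i y
    using distribution_function_bounds F FZ by auto
  show ?thesis
  proof (cases "\<forall>i. 0 < marshall_G (F i) FZ (x i)")
    case True
    then have val: "\<phi> i (marshall_G (F i) FZ (x i)) = F i (x i)" for i
      using gens by (auto simp: generates_def)
    have pos: "0 < F i (x i)" for i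
      using True nonneg(1)[of i "x i"] nonneg(2)[of "x i"] by (auto simp: marshall_G_def zero_less_mult_iff)
    then have "marshall_G (F i) FZ (x i) / F i (x i) = FZ (x i)" for i
      using less_imp_neq[OF pos[of i]] by (simp add: marshall_G_def)
    then show ?thesis by (simp add: marshall_copula_def marshall_H_def val pos min)
  next
    case False
    then obtain i where "\<not> 0 < F i (x i) * FZ (x i)" by (auto simp: marshall_G_def)
    then have i: "F i (x i) * FZ (x i) = 0"
      using mult_nonneg_nonneg[OF nonneg(1)[of i "x i"] nonneg(2)[of "x i"]] by linarith
    then have "marshall_copula \<phi> (\<lambda>i. marshall_G (F i) FZ (x i)) = 0"
      using zero by (auto simp: marshall_copula_def marshall_G_def intro!: exI[of _ i])
    moreover have "marshall_H F FZ x = 0"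
    proof (cases "F i (x i) = 0")
      case False
      \<comment> \<open>Now the shock factor vanishes already at \<open>x i\<close>, hence at the minimum.\<close>
      have "FZ (MIN i. x i) \<le> FZ (x i)"
        by (intro distribution_function_mono[OF FZ] Min_le) auto
      then show ?thesis
        using False i nonneg(2)[of "MIN i. x i"] by (simp add: marshall_H_def)
    qed (auto simp: marshall_H_def)
    ultimately show ?thesis by simp
  qed
qed

lemma marshall_H_mono:
  assumes F: "\<And>i. distribution_function (F i)" and FZ: "distribution_function FZ"
    and le: "\<And>i. F i \<le> F' i"
  shows "marshall_H F FZ x \<le> marshall_H F' FZ x"
  unfolding marshall_H_def
  using distribution_function_bounds F FZ le
  by (intro mult_right_mono prod_mono) (auto simp: le_fun_def)

section \<open>Extrema over a band\<close>

lemma marshall_G_mono: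
  assumes "distribution_function FZ" "F \<le> F'"
  shows "marshall_G F FZ x \<le> marshall_G F' FZ x"
  using assms distribution_function_bounds(1)[of FZ x]
  by (auto simp: marshall_G_def le_fun_def intro: mult_right_mono)

lemma lower_G_eq:
  assumes "distribution_function L" "L \<le> U" "distribution_function FZ"
  shows "lower_G L U FZ = marshall_G L FZ"
proof
  fix x
  show "lower_G L U FZ x = marshall_G L FZ x"
    unfolding lower_G_def using assms
    by (intro cInf_eq_minimum) (auto simp: df_band_def intro: marshall_G_mono)
qed

lemma upper_G_eq:
  assumes "distribution_function U" "L \<le> U" "distribution_function FZ"
  shows "upper_G L U FZ = marshall_G U FZ"
proof
  fix x
  show "upper_G L U FZ x = marshall_G U FZ x"
    unfolding upper_G_def using assms
    by (intro cSup_eq_maximum) (auto simp: df_band_def intro: marshall_G_mono)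
qed

lemma lower_H_eq:
  assumes "\<And>i. distribution_function (L i)" "\<And>i. L i \<le> U i" "distribution_function FZ"
  shows "lower_H L U FZ = marshall_H L FZ"
proof
  fix x
  show "lower_H L U FZ x = marshall_H L FZ x"
    unfolding lower_H_def using assms
    by (intro Least_equality) (auto simp: df_band_def intro!: marshall_H_mono exI[of _ L])
qed

lemma upper_H_eq:
  assumes "\<And>i. distribution_function (U i)" "\<And>i. L i \<le> U i" "distribution_function FZ"
  shows "upper_H L U FZ = marshall_H U FZ"
proof
  fix x
  show "upper_H L U FZ x = marshall_H U FZ x"
    unfolding upper_H_def using assms
    by (intro Greatest_equality) (auto simp: df_band_def intro!: marshall_H_mono exI[of _ U])
qed

section \<open>Distribution functions in the shock model\<close>

lemma shock_model_marginals:
  assumes "shock_model \<Omega> \<A> P X Z F FZ"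
  shows "P {\<omega>\<in>\<Omega>. X i \<omega> \<le> x} = F i x" "P {\<omega>\<in>\<Omega>. Z \<omega> \<le> z} = FZ z"
proof -
  have "df_of \<Omega> P (X i) = F i" "df_of \<Omega> P Z = FZ" using assms by (simp_all add: shock_model_def)
  then show "P {\<omega>\<in>\<Omega>. X i \<omega> \<le> x} = F i x" "P {\<omega>\<in>\<Omega>. Z \<omega> \<le> z} = FZ z"
    by (simp_all add: df_of_def fun_eq_iff)
qed

lemma joint_df_of_shock_model:
  fixes X :: "'n::finite \<Rightarrow> 'w \<Rightarrow> ereal"
  assumes "shock_model \<Omega> \<A> P X Z F FZ"
  shows "joint_df_of \<Omega> P (\<lambda>i \<omega>. max (X i \<omega>) (Z \<omega>)) = marshall_H F FZ"
proof
  fix x :: "'n \<Rightarrow> ereal"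
  have "{\<omega>\<in>\<Omega>. \<forall>i. max (X i \<omega>) (Z \<omega>) \<le> x i}
      = {\<omega>\<in>\<Omega>. (\<forall>i. X i \<omega> \<le> x i) \<and> Z \<omega> \<le> (MIN i. x i)}"
    by auto
  then have "joint_df_of \<Omega> P (\<lambda>i \<omega>. max (X i \<omega>) (Z \<omega>)) x
      = (\<Prod>i\<in>UNIV. P {\<omega>\<in>\<Omega>. X i \<omega> \<le> x i}) * P {\<omega>\<in>\<Omega>. Z \<omega> \<le> (MIN i. x i)}"
    using assms unfolding joint_df_of_def shock_model_def by metis
  also have "\<dots> = marshall_H F FZ x"
    unfolding marshall_H_def shock_model_marginals[OF assms] ..
  finally show "joint_df_of \<Omega> P (\<lambda>i \<omega>. max (X i \<omega>) (Z \<omega>)) x = marshall_H F FZ x" .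
qed

text \<open>The pair \<open>X i\<close>, \<open>Z\<close> is independent because the remaining events \<open>{X j \<le> \<infinity>}\<close> are sure.\<close>

lemma df_of_shock_model:
  assumes "shock_model \<Omega> \<A> P X Z F FZ"
  shows "df_of \<Omega> P (\<lambda>\<omega>. max (X i \<omega>) (Z \<omega>)) = marshall_G (F i) FZ"
proof
  fix x :: ereal
  let ?x = "(\<lambda>j. \<infinity>)(i := x)"
  have "{\<omega>\<in>\<Omega>. max (X i \<omega>) (Z \<omega>) \<le> x} = {\<omega>\<in>\<Omega>. (\<forall>j. X j \<omega> \<le> ?x j) \<and> Z \<omega> \<le> x}"
    by auto
  then have "df_of \<Omega> P (\<lambda>\<omega>. max (X i \<omega>) (Z \<omega>)) x
      = (\<Prod>j\<in>UNIV. P {\<omega>\<in>\<Omega>. X j \<omega> \<le> ?x j}) * P {\<omega>\<in>\<Omega>. Z \<omega> \<le> x}"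
    using assms unfolding df_of_def shock_model_def by metis
  also have "(\<Prod>j\<in>UNIV. P {\<omega>\<in>\<Omega>. X j \<omega> \<le> ?x j})
      = P {\<omega>\<in>\<Omega>. X i \<omega> \<le> x} * (\<Prod>j\<in>UNIV - {i}. P \<Omega>)"
    by (subst prod.remove[of UNIV i]) (auto intro!: prod.cong)
  also have "\<dots> = P {\<omega>\<in>\<Omega>. X i \<omega> \<le> x}"
    using assms by (simp add: shock_model_def fa_prob_def)
  also have "P {\<omega>\<in>\<Omega>. X i \<omega> \<le> x} * P {\<omega>\<in>\<Omega>. Z \<omega> \<le> x} = marshall_G (F i) FZ x"
    unfolding marshall_G_def shock_model_marginals[OF assms] ..
  finally show "df_of \<Omega> P (\<lambda>\<omega>. max (X i \<omega>) (Z \<omega>)) x = marshall_G (F i) FZ x" .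
qed

section \<open>The imprecise Marshall shock model\<close>

text \<open>The margin \<open>F\<close> cancels, so that generators of different margins, and the lower and the upper
  one, have the same quotient at corresponding points.\<close>

lemma gen_star_marshall_G:
  assumes "generates \<phi> (marshall_G F FZ) F" "0 < marshall_G F FZ x"
  shows "gen_star \<phi> (marshall_G F FZ x) = 1 / FZ x"
proof -
  have "\<phi> (marshall_G F FZ x) = F x" using assms by (simp add: generates_def)
  moreover have "F x \<noteq> 0" using assms(2) by (auto simp: marshall_G_def)
  ultimately show ?thesis by (simp add: gen_star_def marshall_G_def)
qed

theorem theorem10:
  fixes Fl Fu F :: "'n::finite \<Rightarrow> ereal \<Rightarrow> real"
    and FZ :: "ereal \<Rightarrow> real"
    and G Gl Gu :: "'n \<Rightarrow> ereal \<Rightarrow> real"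
    and H Hl Hu :: "('n \<Rightarrow> ereal) \<Rightarrow> real"
    and \<phi> \<phi>l \<phi>u :: "'n \<Rightarrow> real \<Rightarrow> real"
    and \<Omega> :: "'w set" and \<A> :: "'w set set" and P :: "'w set \<Rightarrow> real"
    and X :: "'n \<Rightarrow> 'w \<Rightarrow> ereal" and Z :: "'w \<Rightarrow> ereal"
  assumes "\<And>i. distribution_function (Fl i)"
    and "\<And>i. distribution_function (Fu i)"
    and "\<And>i. Fl i \<le> Fu i"
    and "distribution_function FZ"
    and "\<And>i. F i \<in> df_band (Fl i) (Fu i)"
    and "\<And>i. G i = marshall_G (F i) FZ"
    and "\<And>i. Gl i = lower_G (Fl i) (Fu i) FZ"
    and "\<And>i. Gu i = upper_G (Fl i) (Fu i) FZ"
    and "H = marshall_H F FZ"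
    and "Hl = lower_H Fl Fu FZ"
    and "Hu = upper_H Fl Fu FZ"
    and "\<And>i. is_extension (F i) FZ (\<phi> i)"
    and "\<And>i. minimal_generator (Gl i) (Fl i) (\<phi>l i)"
    and "\<And>i. maximal_generator (Gu i) (Fu i) (\<phi>u i)"
  shows "
    \<comment> \<open>(i)\<close>
    (\<forall>i. le_on_unit (\<phi>l i) (\<phi>u i)) \<and>
    \<comment> \<open>(ii)\<close>
    (\<forall>C \<in> imprecise_marshall_copula \<phi>l \<phi>u. \<forall>u. (\<forall>i. u i \<in> {0..1}) \<longrightarrow>
        marshall_copula \<phi>l u \<le> C u \<and> C u \<le> marshall_copula \<phi>u u) \<and>
    \<comment> \<open>(iii), including that \<open>G i\<close> is the distribution function of \<open>max (X i) Z\<close>\<close>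
    (shock_model \<Omega> \<A> P X Z F FZ \<longrightarrow>
        (\<forall>i. df_of \<Omega> P (\<lambda>\<omega>. max (X i \<omega>) (Z \<omega>)) = G i)) \<and>
    (\<forall>i x. G i x = F i x * FZ x \<and> Gl i x = Fl i x * FZ x \<and> Gu i x = Fu i x * FZ x) \<and>
    \<comment> \<open>(iv)\<close>
    (\<forall>i x. (G i x > 0 \<longrightarrow> \<phi> i (G i x) = F i x) \<and>
           (Gl i x > 0 \<longrightarrow> \<phi>l i (Gl i x) = Fl i x) \<and>
           (Gu i x > 0 \<longrightarrow> \<phi>u i (Gu i x) = Fu i x)) \<and>
    \<comment> \<open>(v)\<close>
    (\<forall>x. marshall_copula \<phi>l (\<lambda>i. Gl i (x i)) \<le> marshall_copula \<phi> (\<lambda>i. G i (x i)) \<and>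
         marshall_copula \<phi> (\<lambda>i. G i (x i)) \<le> marshall_copula \<phi>u (\<lambda>i. Gu i (x i))) \<and>
    \<comment> \<open>(vi), including that \<open>H\<close> is the joint distribution function of the \<open>max (X i) Z\<close>\<close>
    (shock_model \<Omega> \<A> P X Z F FZ \<longrightarrow>
        joint_df_of \<Omega> P (\<lambda>i \<omega>. max (X i \<omega>) (Z \<omega>)) = H) \<and>
    (\<forall>x. H x = marshall_copula \<phi> (\<lambda>i. G i (x i)) \<and>
         Hl x = marshall_copula \<phi>l (\<lambda>i. Gl i (x i)) \<and>
         Hu x = marshall_copula \<phi>u (\<lambda>i. Gu i (x i))) \<and>
    \<comment> \<open>(vii)\<close>
    (\<forall>i j x. Gl i x > 0 \<and> Gu j x > 0 \<longrightarrow>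
        gen_star (\<phi>l i) (Gl i x) = gen_star (\<phi>u j) (Gu j x))"
proof -
  note Fl = assms(1) and Fu = assms(2) and le = assms(3) and FZ = assms(4)
  have F: "distribution_function (F i)" "Fl i \<le> F i" "F i \<le> Fu i" for i
    using assms(5)[of i] by (auto simp: df_band_def)
  have G: "G i = marshall_G (F i) FZ" "Gl i = marshall_G (Fl i) FZ" "Gu i = marshall_G (Fu i) FZ"
    for i
    using assms(6-8) lower_G_eq[OF Fl le FZ] upper_G_eq[OF Fu le FZ] by auto
  have H: "H = marshall_H F FZ" "Hl = marshall_H Fl FZ" "Hu = marshall_H Fu FZ"
    using assms(9-11) lower_H_eq[of Fl Fu, OF Fl le FZ] upper_H_eq[of Fu Fl, OF Fu le FZ] by auto
  have min: "minimal_generator (marshall_G (Fl i) FZ) (Fl i) (\<phi>l i)"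
    and max: "maximal_generator (marshall_G (Fu i) FZ) (Fu i) (\<phi>u i)" for i
    using assms(13)[of i] assms(14)[of i] by (auto simp: G)
  have gens: "generates (\<phi> i) (marshall_G (F i) FZ) (F i)"
    "generates (\<phi>l i) (marshall_G (Fl i) FZ) (Fl i)"
    "generates (\<phi>u i) (marshall_G (Fu i) FZ) (Fu i)" for i
    using is_extension_generates[OF F(1) FZ assms(12)] min[of i] max[of i]
    by (auto simp: minimal_generator_def maximal_generator_def)
  have zero: "\<phi> i 0 = 0" "\<phi>l i 0 = 0" "\<phi>u i 0 = 0" for i
    using assms(12)[of i] min[of i] max[of i]
    by (simp_all add: minimal_generator_def maximal_generator_def is_extension_def generator_def)

  have i: "\<forall>i. le_on_unit (\<phi>l i) (\<phi>u i)"
    using minimal_generator_le_maximal[OF Fl Fu le FZ min max] by blast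
  have ii: "marshall_copula \<phi>l u \<le> C u \<and> C u \<le> marshall_copula \<phi>u u"
    if "C \<in> imprecise_marshall_copula \<phi>l \<phi>u" "\<forall>i. u i \<in> {0..1}" for C u
    using that unfolding imprecise_marshall_copula_def
    by (auto simp: le_on_unit_def intro!: marshall_copula_mono)
  have iii: "G i x = F i x * FZ x \<and> Gl i x = Fl i x * FZ x \<and> Gu i x = Fu i x * FZ x" for i x
    by (simp add: G marshall_G_def)
  have iv: "(G i x > 0 \<longrightarrow> \<phi> i (G i x) = F i x) \<and>
      (Gl i x > 0 \<longrightarrow> \<phi>l i (Gl i x) = Fl i x) \<and>
      (Gu i x > 0 \<longrightarrow> \<phi>u i (Gu i x) = Fu i x)" for i x
    using gens[of i] by (simp add: G generates_def)
  have vi: "H x = marshall_copula \<phi> (\<lambda>i. G i (x i)) \<and>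
      Hl x = marshall_copula \<phi>l (\<lambda>i. Gl i (x i)) \<and>
      Hu x = marshall_copula \<phi>u (\<lambda>i. Gu i (x i))" for x
    using marshall_H_eq_copula[of F FZ \<phi> x, OF F(1) FZ zero(1) gens(1)]
      marshall_H_eq_copula[of Fl FZ \<phi>l x, OF Fl FZ zero(2) gens(2)]
      marshall_H_eq_copula[of Fu FZ \<phi>u x, OF Fu FZ zero(3) gens(3)]
    by (simp add: G H)
  have v: "marshall_copula \<phi>l (\<lambda>i. Gl i (x i)) \<le> marshall_copula \<phi> (\<lambda>i. G i (x i)) \<and>
      marshall_copula \<phi> (\<lambda>i. G i (x i)) \<le> marshall_copula \<phi>u (\<lambda>i. Gu i (x i))" for x
    using vi[of x] marshall_H_mono[of Fl FZ F x, OF Fl FZ F(2)]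
      marshall_H_mono[of F FZ Fu x, OF F(1) FZ F(3)]
    by (simp add: H)
  have vii: "gen_star (\<phi>l i) (Gl i x) = gen_star (\<phi>u j) (Gu j x)"
    if "Gl i x > 0 \<and> Gu j x > 0" for i j x
    using that gen_star_marshall_G[OF gens(2)] gen_star_marshall_G[OF gens(3)] by (simp add: G)
  have shock: "df_of \<Omega> P (\<lambda>\<omega>. max (X i \<omega>) (Z \<omega>)) = G i"
    "joint_df_of \<Omega> P (\<lambda>i \<omega>. max (X i \<omega>) (Z \<omega>)) = H"
    if "shock_model \<Omega> \<A> P X Z F FZ" for i
    using df_of_shock_model[OF that] joint_df_of_shock_model[OF that] by (simp_all add: G H)
  show ?thesis
    using i ii iii iv v vi vii shock by blast
qed

end
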